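(* Let $(A,\cdot,\circ)$ be a left Novikov-Poisson algebra over a field of characteristic zero, and fix $u\in A$. Then $(A,\llbracket\circ,\cdot\rrbracket,\llbracket\cdot,\circ\rrbracket)$, where the Kantor products are taken with respect to $u$, is a left Novikov-Poisson algebra.
   Context: For bilinear multiplications $P,Q$ on a vector space $V$ and a fixed $u\in V$, the Kantor product $\llbracket P,Q\rrbracket$ (with respect to $u$) is the bilinear multiplication $\llbracket P,Q\rrbracket(x,y)=P(u,Q(x,y))-Q(P(u,x),y)-Q(x,P(u,y))$. A left Novikov algebra is an algebra $(A,\circ)$ satisfying $x\circ(y\circ z)=y\circ(x\circ z)$ and $(x\circ y)\circ z-x\circ(y\circ z)=(x\circ z)\circ y-x\circ(z\circ y)$ for all $x,y,z$. A left Novikov-Poisson algebra $(A,\cdot,\circ)$ is a vector space with two bilinear operations such that $(A,\cdot)$ is an associative commutative algebra (with $xy:=x\cdot y$, not necessarily unital), $(A,\circ)$ is a left Novikov algebra, and for all $x,y,z\in A$: $x\circ(yz)=(x\circ y)z$ and $(xy)\circ z-x(y\circ z)=(xz)\circ y-x(z\circ y)$. In the triple $(A,\llbracket\circ,\cdot\rrbracket,\llbracket\cdot,\circ\rrbracket)$ the first product plays the role of $\cdot$ and the second the role of $\circ$. *)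

theory Defs
  imports Complex_Main
begin

text \<open>
  An algebra is a vector space (over the field of scalars, with the whole type as carrier)
  with a bilinear multiplication; neither associativity nor a unit is required.
\<close>

locale algebra_over = vector_space scale
  for scale :: "'k::field \<Rightarrow> 'a::ab_group_add \<Rightarrow> 'a" +
  fixes prod :: "'a \<Rightarrow> 'a \<Rightarrow> 'a"
  assumes linear_left: "Vector_Spaces.linear scale scale (\<lambda>x. prod x y)"
    and linear_right: "Vector_Spaces.linear scale scale (\<lambda>y. prod x y)"

locale assoc_comm_algebra = algebra_over scale mult
  for scale :: "'k::field \<Rightarrow> 'a::ab_group_add \<Rightarrow> 'a"
    and mult :: "'a \<Rightarrow> 'a \<Rightarrow> 'a" (infixl "\<cdot>" 70) +
  assumes mult_assoc: "(x \<cdot> y) \<cdot> z = x \<cdot> (y \<cdot> z)"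
    and mult_commute: "x \<cdot> y = y \<cdot> x"

locale left_novikov_algebra = algebra_over scale circ
  for scale :: "'k::field \<Rightarrow> 'a::ab_group_add \<Rightarrow> 'a"
    and circ :: "'a \<Rightarrow> 'a \<Rightarrow> 'a" (infixl "\<odot>" 70) +
  assumes left_commute: "x \<odot> (y \<odot> z) = y \<odot> (x \<odot> z)"
    and right_symmetric:
      "(x \<odot> y) \<odot> z - x \<odot> (y \<odot> z) = (x \<odot> z) \<odot> y - x \<odot> (z \<odot> y)"

locale left_novikov_poisson_algebra =
  mult: assoc_comm_algebra scale mult + circ: left_novikov_algebra scale circ
  for scale :: "'k::field \<Rightarrow> 'a::ab_group_add \<Rightarrow> 'a"
    and mult :: "'a \<Rightarrow> 'a \<Rightarrow> 'a" (infixl "\<cdot>" 70)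
    and circ :: "'a \<Rightarrow> 'a \<Rightarrow> 'a" (infixl "\<odot>" 70) +
  assumes circ_mult: "x \<odot> (y \<cdot> z) = (x \<odot> y) \<cdot> z"
    and mult_circ_symmetric:
      "(x \<cdot> y) \<odot> z - x \<cdot> (y \<odot> z) = (x \<cdot> z) \<odot> y - x \<cdot> (z \<odot> y)"

definition kantor_product ::
    "'a::ab_group_add \<Rightarrow> ('a \<Rightarrow> 'a \<Rightarrow> 'a) \<Rightarrow> ('a \<Rightarrow> 'a \<Rightarrow> 'a) \<Rightarrow> 'a \<Rightarrow> 'a \<Rightarrow> 'a"
  where "kantor_product u P Q x y = P u (Q x y) - Q (P u x) y - Q x (P u y)"

end

theory Submission
  imports Defs
begin

text \<open>
  The compatibility law \<open>x \<odot> (y \<cdot> z) = (x \<odot> y) \<cdot> z\<close> says that every left multiplication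
  \<open>x \<odot> _\<close> is an endomorphism of the module \<open>A\<close> over the commutative algebra \<open>(A, \<cdot>)\<close>.
  Two of the three terms of each Kantor product therefore coincide up to sign and cancel,
  which leaves, with \<open>T = u \<odot> _\<close>,
  \<open>\<lbrakk>\<odot>, \<cdot>\<rbrakk> x y = - T (x \<cdot> y)\<close> and \<open>\<lbrakk>\<cdot>, \<odot>\<rbrakk> x y = - ((u \<cdot> x) \<odot> y)\<close>
  (lemmas \<open>kantor_circ_mult\<close> and \<open>kantor_mult_circ\<close>).

  For these two products each axiom reduces to an axiom of the given algebra. The first one
  inherits commutativity, and it is associative because \<open>T\<close> is a module map. Left commutativity of the
  second product is left commutativity of \<open>\<odot>\<close>, and so is the compatibility of the two: it
  says that the module maps \<open>(u \<cdot> x) \<odot> _\<close> and \<open>T\<close> commute. In the two laws that say that some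
  expression in \<open>y\<close> and \<open>z\<close> is symmetric, the left multiplications being module maps lets
  a factor \<open>u\<close> be attached to \<open>y\<close> on one side and to \<open>z\<close> on the other. One use of the old law
  moves this \<open>u\<close> into the right argument of \<open>\<odot>\<close>, from where it comes out as a factor of the
  whole expression; what remains is again an instance of the old law
  (lemmas \<open>right_symmetric_scaled\<close> and \<open>mult_circ_symmetric_scaled\<close>).
\<close>

lemma algebra_over_kantor_product:
  assumes "algebra_over scale P" and "algebra_over scale Q"
  shows "algebra_over scale (kantor_product u P Q)"
proof -
  interpret P: algebra_over scale P by fact
  interpret Q: algebra_over scale Q by fact
  interpret vector_space_pair scale scale ..
  note compose = Vector_Spaces.linear_compose[unfolded comp_def]
  show ?thesis
  proof (intro algebra_over.intro algebra_over_axioms.intro P.vector_space_axioms)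
    show "Vector_Spaces.linear scale scale (\<lambda>x. kantor_product u P Q x y)" for y
      unfolding kantor_product_def
      by (intro linear_compose_sub compose[OF Q.linear_left P.linear_right]
          compose[OF P.linear_right Q.linear_left] Q.linear_left)
    show "Vector_Spaces.linear scale scale (\<lambda>y. kantor_product u P Q x y)" for x
      unfolding kantor_product_def
      by (intro linear_compose_sub compose[OF Q.linear_right P.linear_right]
          compose[OF P.linear_right Q.linear_right] Q.linear_right)
  qed
qed

context algebra_over
begin

lemma prod_minus_left: "prod (- x) y = - prod x y"
  by (rule Vector_Spaces.linear.axioms(3)[OF linear_left, THEN module_hom.neg])

lemma prod_minus_right: "prod x (- y) = - prod x y"
  by (rule Vector_Spaces.linear.axioms(3)[OF linear_right, THEN module_hom.neg])

lemma prod_diff_right: "prod x (y - z) = prod x y - prod x z"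
  by (rule Vector_Spaces.linear.axioms(3)[OF linear_right, THEN module_hom.diff])

end

context left_novikov_poisson_algebra
begin

lemma mult_left_commute: "x \<cdot> (y \<cdot> z) = y \<cdot> (x \<cdot> z)"
  by (metis mult.mult_assoc mult.mult_commute)

lemma circ_mult_right: "x \<odot> (y \<cdot> z) = y \<cdot> (x \<odot> z)"
  by (metis circ_mult mult.mult_commute)

lemma kantor_circ_mult: "kantor_product u (\<odot>) (\<cdot>) x y = - (u \<odot> (x \<cdot> y))"
  by (simp add: kantor_product_def circ_mult[symmetric] circ_mult_right[symmetric])

lemma kantor_mult_circ: "kantor_product u (\<cdot>) (\<odot>) x y = - ((u \<cdot> x) \<odot> y)"
  by (simp add: kantor_product_def circ_mult_right)

lemmas minus_simps =
  mult.prod_minus_left mult.prod_minus_right circ.prod_minus_left circ.prod_minus_right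

text \<open>
  Exchanging \<open>u \<cdot> y\<close> and \<open>z\<close> by right symmetry puts \<open>u \<cdot> y\<close> into the last position, from where
  \<open>u\<close> can be pulled out. The left-hand side is thus \<open>u\<close> times the associator of \<open>\<odot>\<close> at
  \<open>a\<close>, \<open>z\<close>, \<open>y\<close>, and that is symmetric in \<open>y\<close> and \<open>z\<close>.
\<close>

lemma right_symmetric_scaled:
  "(a \<odot> (u \<cdot> y)) \<odot> z - a \<odot> ((u \<cdot> y) \<odot> z) = (a \<odot> (u \<cdot> z)) \<odot> y - a \<odot> ((u \<cdot> z) \<odot> y)"
proof -
  have factor: "(a \<odot> (u \<cdot> y)) \<odot> z - a \<odot> ((u \<cdot> y) \<odot> z)
      = u \<cdot> ((a \<odot> z) \<odot> y - a \<odot> (z \<odot> y))" for y z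
    using circ.right_symmetric[of a "u \<cdot> y" z]
    by (simp add: circ_mult_right mult.prod_diff_right)
  show ?thesis
    unfolding factor by (simp add: circ.right_symmetric)
qed

text \<open>
  The same exchange of \<open>u \<cdot> y\<close> and \<open>z\<close>, now by the mixed symmetry law.
\<close>

lemma mult_circ_symmetric_scaled:
  "(a \<cdot> (u \<cdot> y)) \<odot> z - a \<cdot> ((u \<cdot> y) \<odot> z) = (a \<cdot> (u \<cdot> z)) \<odot> y - a \<cdot> ((u \<cdot> z) \<odot> y)"
proof -
  have factor: "(a \<cdot> (u \<cdot> y)) \<odot> z - a \<cdot> ((u \<cdot> y) \<odot> z)
      = u \<cdot> ((a \<cdot> z) \<odot> y - a \<cdot> (z \<odot> y))" for y z
    using mult_circ_symmetric[of a "u \<cdot> y" z]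
    by (simp add: circ_mult_right mult.prod_diff_right mult_left_commute[of a u])
  show ?thesis
    unfolding factor by (simp add: mult_circ_symmetric)
qed

lemma kantor_left_novikov_poisson:
  "left_novikov_poisson_algebra scale
     (kantor_product u (\<odot>) (\<cdot>)) (kantor_product u (\<cdot>) (\<odot>))"
proof (intro left_novikov_poisson_algebra.intro assoc_comm_algebra.intro
    left_novikov_algebra.intro algebra_over_kantor_product
    mult.algebra_over_axioms circ.algebra_over_axioms
    assoc_comm_algebra_axioms.intro left_novikov_algebra_axioms.intro
    left_novikov_poisson_algebra_axioms.intro,
    unfold kantor_circ_mult kantor_mult_circ minus_simps minus_minus neg_equal_iff_equal)
  fix x y z
  show "u \<odot> ((u \<odot> (x \<cdot> y)) \<cdot> z) = u \<odot> (x \<cdot> (u \<odot> (y \<cdot> z)))"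
    by (simp add: circ_mult[symmetric] circ_mult_right[symmetric] mult.mult_assoc)
  show "u \<odot> (x \<cdot> y) = u \<odot> (y \<cdot> x)"
    by (simp add: mult.mult_commute)
  show "(u \<cdot> x) \<odot> ((u \<cdot> y) \<odot> z) = (u \<cdot> y) \<odot> ((u \<cdot> x) \<odot> z)"
    by (simp add: circ.left_commute)
  show "(u \<cdot> ((u \<cdot> x) \<odot> y)) \<odot> z - (u \<cdot> x) \<odot> ((u \<cdot> y) \<odot> z)
      = (u \<cdot> ((u \<cdot> x) \<odot> z)) \<odot> y - (u \<cdot> x) \<odot> ((u \<cdot> z) \<odot> y)"
    using right_symmetric_scaled[of "u \<cdot> x" u y z] by (simp add: circ_mult_right)
  show "(u \<cdot> x) \<odot> (u \<odot> (y \<cdot> z)) = u \<odot> (((u \<cdot> x) \<odot> y) \<cdot> z)"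
    by (simp add: circ_mult[symmetric] circ.left_commute)
  \<comment> \<open>As \<open>u \<odot> _\<close> is a module map, it can act on the factor \<open>x\<close> alone; hence \<open>a = u \<odot> x\<close> below.\<close>
  show "(u \<cdot> (u \<odot> (x \<cdot> y))) \<odot> z - u \<odot> (x \<cdot> ((u \<cdot> y) \<odot> z))
      = (u \<cdot> (u \<odot> (x \<cdot> z))) \<odot> y - u \<odot> (x \<cdot> ((u \<cdot> z) \<odot> y))"
    unfolding circ_mult[of u x] mult_left_commute[of u "u \<odot> x"] by (rule mult_circ_symmetric_scaled)
qed

end

theorem corollary31:
  fixes scale :: "'k::field_char_0 \<Rightarrow> 'a::ab_group_add \<Rightarrow> 'a"
    and mult circ :: "'a \<Rightarrow> 'a \<Rightarrow> 'a"
    and u :: 'a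
  assumes "left_novikov_poisson_algebra scale mult circ"
  shows "left_novikov_poisson_algebra scale
           (kantor_product u circ mult) (kantor_product u mult circ)"
  using assms by (rule left_novikov_poisson_algebra.kantor_left_novikov_poisson)

end
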